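(* Let $C\subseteq\mathbb{Z}_2^n$ be a $13$-cap of dimension $7$ with basis $B$, and write $D=C\setminus B=\{x_1,\dots,x_5\}$ and $B_{ij}=B_{x_i}\cap B_{x_j}$. Then $B$ has type $5\text{-}5\text{-}5\text{-}5\text{-}5$, and there are two disjoint pairs $\{i,j\},\{k,\ell\}\subseteq\{1,\dots,5\}$ with $|B_{ij}|=|B_{k\ell}|=2$, while $|B_{st}|=3$ for all other pairs $\{s,t\}$.
   Context: Work in $\mathbb{Z}_2^n$. An affine combination of a set is a sum of an odd number of its distinct elements; $\operatorname{aff}(S)$ is the set of all affine combinations of elements of $S$, and the dimension of $S$ is the dimension of the affine flat $\operatorname{aff}(S)$. A basis for $S$ is a subset $B\subseteq S$ that is affinely independent (no element is an affine combination of the others) with $\operatorname{aff}(B)=\operatorname{aff}(S)$; its dependent set is $D=S\setminus B$. For $x\in D$, $B_x$ is the unique subset of $B$ whose elements sum to $x$. A quad is a set of four distinct elements summing to $\mathbf{0}$; a cap is a quad-free subset; a $k$-cap is a cap with $k$ elements. The type of $B$ is the list of the numbers $|B_x|$, $x\in D$, in nonincreasing order, separated by hyphens. *)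

theory Defs
  imports "HOL-Analysis.Analysis" "HOL-Library.Z2" "HOL-Library.Multiset"
begin

definition aff :: "(bit ^ 'n) set \<Rightarrow> (bit ^ 'n) set" where
  "aff S = {\<Sum>T | T. T \<subseteq> S \<and> finite T \<and> odd (card T)}"

(* The dimension of a nonempty flat is that of its direction space; vec.dim is
   linear dimension over the coefficient field, here bit. The empty set gets 0. *)
definition flat_dim :: "(bit ^ 'n) set \<Rightarrow> nat" where
  "flat_dim F = vec.dim {x - y | x y. x \<in> F \<and> y \<in> F}"

definition cap_dim :: "(bit ^ 'n) set \<Rightarrow> nat" where
  "cap_dim S = flat_dim (aff S)"

definition aff_indep :: "(bit ^ 'n) set \<Rightarrow> bool" where
  "aff_indep B \<longleftrightarrow> (\<forall>x\<in>B. x \<notin> aff (B - {x}))"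

definition aff_basis :: "(bit ^ 'n) set \<Rightarrow> (bit ^ 'n) set \<Rightarrow> bool" where
  "aff_basis B S \<longleftrightarrow> B \<subseteq> S \<and> aff_indep B \<and> aff B = aff S"

(* Only subsets of odd size (affine combinations) are considered: without this the
   subset need not be unique, since for instance e1 + e2 = 0 + e1 + e2 if B = {0, e1, e2}. *)
definition basis_rep :: "(bit ^ 'n) set \<Rightarrow> bit ^ 'n \<Rightarrow> (bit ^ 'n) set" where
  "basis_rep B x = (THE T. T \<subseteq> B \<and> odd (card T) \<and> \<Sum>T = x)"

definition quad :: "(bit ^ 'n) set \<Rightarrow> bool" where
  "quad Q \<longleftrightarrow> card Q = 4 \<and> \<Sum>Q = 0"

definition cap :: "(bit ^ 'n) set \<Rightarrow> bool" where
  "cap C \<longleftrightarrow> \<not> (\<exists>Q\<subseteq>C. quad Q)"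

definition basis_type :: "(bit ^ 'n) set \<Rightarrow> (bit ^ 'n) set \<Rightarrow> nat list" where
  "basis_type S B =
     rev (sorted_list_of_multiset (image_mset (\<lambda>x. card (basis_rep B x)) (mset_set (S - B))))"

end

theory Submission
  imports Defs
begin

text \<open>
  In a cap, a nonempty subset of even size with sum zero has at least six elements, since sizes 2
  and 4 are excluded. Applied to a nonempty \<open>I \<subseteq> C - B\<close> together with the symmetric difference
  of the \<open>B\<^sub>x\<close> for \<open>x \<in> I\<close>, this bounds that symmetric difference from below by \<open>6 - |I|\<close>.

  In dimension 7 the basis has 8 elements. For the complements \<open>A\<^sub>x = B - B\<^sub>x\<close> the bounds say that
  each \<open>|A\<^sub>x|\<close> is 1 or 3, that no element lies in three of them, that two of them share at most one
  element, and that an \<open>A\<^sub>x\<close> of size 3 is disjoint from at most one other. If some \<open>A\<^sub>p\<close> has size 1,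
  the others meet pairwise in one element, so four of them would have empty symmetric difference;
  this leaves room for at most four dependent points. With five dependent points every \<open>A\<^sub>x\<close>
  therefore has size 3 and meets at most three of the other four, so it is disjoint from exactly
  one, its partner. Two points that are not each other's partners yield the two disjoint pairs, and
  any further disjoint pair would have to avoid all four of their points.

  Five points cannot be grouped completely into pairs of partners, so there is in fact no 13-cap of
  dimension 7. The proof does not use this: it derives the type and the intersection sizes directly.
\<close>

subsection \<open>Symmetric differences\<close>

lemma card_sym_diff:
  assumes "finite A" "finite B"
  shows "card (sym_diff A B) + 2 * card (A \<inter> B) = card A + card B"
proof -
  have "card (sym_diff A B) = card (A - B) + card (B - A)"
    using assms by (intro card_Un_disjoint) auto
  moreover have "card A = card (A \<inter> B) + card (A - B)" "card B = card (A \<inter> B) + card (B - A)"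
    using card_Int_Diff[OF assms(1), of B] card_Int_Diff[OF assms(2), of A]
    by (simp_all add: Int_commute)
  ultimately show ?thesis by simp
qed

lemma card_sym_diff_3:
  assumes "finite A" "finite B" "finite C"
  shows "card (sym_diff A (sym_diff B C)) + 2 * (card (A \<inter> B) + card (A \<inter> C) + card (B \<inter> C)) =
    card A + card B + card C + 4 * card (A \<inter> B \<inter> C)"
proof -
  have "A \<inter> sym_diff B C = sym_diff (A \<inter> B) (A \<inter> C)" "(A \<inter> B) \<inter> (A \<inter> C) = A \<inter> B \<inter> C"
    by blast+
  then show ?thesis
    using card_sym_diff[of A "sym_diff B C"] card_sym_diff[of B C]
      card_sym_diff[of "A \<inter> B" "A \<inter> C"] assms by simp
qed

lemma even_card_sym_diff:
  assumes "finite A" "finite B"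
  shows "even (card (sym_diff A B)) \<longleftrightarrow> even (card A + card B)"
  by (simp flip: card_sym_diff[OF assms])

definition sym_diff_family :: "('i \<Rightarrow> 'a set) \<Rightarrow> 'i set \<Rightarrow> 'a set" where
  "sym_diff_family A I = {a. odd (card {i \<in> I. a \<in> A i})}"

lemma sym_diff_family_empty [simp]: "sym_diff_family A {} = {}"
  by (simp add: sym_diff_family_def)

lemma sym_diff_family_insert [simp]:
  assumes "finite I" "i \<notin> I"
  shows "sym_diff_family A (insert i I) = sym_diff (A i) (sym_diff_family A I)"
proof -
  have "{j \<in> insert i I. a \<in> A j} =
      (if a \<in> A i then insert i {j \<in> I. a \<in> A j} else {j \<in> I. a \<in> A j})" for a
    by auto
  then show ?thesis
    using assms by (auto simp: sym_diff_family_def)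
qed

lemma sym_diff_family_subset:
  assumes "\<And>i. i \<in> I \<Longrightarrow> A i \<subseteq> U"
  shows "sym_diff_family A I \<subseteq> U"
proof
  fix a assume "a \<in> sym_diff_family A I"
  then have "{i \<in> I. a \<in> A i} \<noteq> {}"
    by (auto simp: sym_diff_family_def simp del: Collect_empty_eq)
  then show "a \<in> U" using assms by blast
qed

lemma finite_sym_diff_family:
  assumes "finite I" "\<And>i. i \<in> I \<Longrightarrow> finite (A i)"
  shows "finite (sym_diff_family A I)"
  by (rule finite_subset[OF sym_diff_family_subset[of I A "\<Union>i\<in>I. A i"]]) (use assms in auto)

lemma even_card_sym_diff_family:
  assumes "finite I" "\<And>i. i \<in> I \<Longrightarrow> finite (A i)"
  shows "even (card (sym_diff_family A I)) \<longleftrightarrow> even (\<Sum>i\<in>I. card (A i))"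
  using assms
proof (induction I)
  case (insert i I)
  then show ?case
    using even_card_sym_diff[of "A i" "sym_diff_family A I"] finite_sym_diff_family[of I A]
    by simp
qed simp

lemma sym_diff_family_Diff:
  assumes "finite I" "\<And>i. i \<in> I \<Longrightarrow> A i \<subseteq> U"
  shows "sym_diff_family (\<lambda>i. U - A i) I =
    (if even (card I) then sym_diff_family A I else U - sym_diff_family A I)"
  using assms
proof (induction I)
  case (insert i I)
  have "sym_diff_family A I \<subseteq> U" using insert.prems by (intro sym_diff_family_subset) auto
  moreover have "A i \<subseteq> U" using insert.prems by simp
  ultimately show ?case using insert by auto
qed simp

subsection \<open>Matchings\<close>

definition matching_on :: "'a set \<Rightarrow> ('a \<Rightarrow> 'a \<Rightarrow> bool) \<Rightarrow> bool" where
  "matching_on V R \<longleftrightarrow> symp_on V R \<and> (\<forall>s\<in>V. \<forall>t\<in>V. \<forall>u\<in>V. R s t \<and> R s u \<longrightarrow> t = u)"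

lemma matching_onD:
  assumes "matching_on V R" "s \<in> V" "t \<in> V" "R s t"
  shows "R t s" and "u \<in> V \<Longrightarrow> R s u \<Longrightarrow> u = t"
  using assms unfolding matching_on_def symp_on_def by blast+

lemma matching_on_reindex:
  assumes "matching_on V R" "inj_on f I" "f ` I \<subseteq> V"
  shows "matching_on I (\<lambda>s t. R (f s) (f t))"
  using assms unfolding matching_on_def symp_on_def inj_on_def by blast

lemma matching_on_edge_eq:
  assumes matching: "matching_on V R" and "u \<in> V" "v \<in> V" "R u v" "q \<in> V" "R p q" "p \<in> {u, v}"
  shows "{p, q} = {u, v}"
proof (cases "p = u")
  case True
  then have "q = v" using matching_onD(2)[OF matching, of u v q] assms by blast
  with True show ?thesis by simp
next
  case False
  then have "p = v" using assms by blast
  moreover have "R v u" using matching_onD(1)[OF matching, of u v] assms by blast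
  ultimately have "q = u" using matching_onD(2)[OF matching, of v u q] assms by blast
  with \<open>p = v\<close> show ?thesis by blast
qed

lemma obtain_two_disjoint_edges:
  assumes "3 \<le> card V" and matching: "matching_on V R"
    and partner: "\<And>s. s \<in> V \<Longrightarrow> \<exists>t\<in>V - {s}. R s t"
  obtains i j k l where "{i, j, k, l} \<subseteq> V" "distinct [i, j, k, l]" "R i j" "R k l"
proof -
  obtain i where i_in: "i \<in> V" using assms(1) by fastforce
  then obtain j where j_partner: "j \<in> V - {i}" "R i j" using partner by blast
  have "\<not> V \<subseteq> {i, j}"
  proof
    assume "V \<subseteq> {i, j}"
    then have "card V \<le> card {i, j}" by (intro card_mono) auto
    also have "\<dots> \<le> 2" by (simp add: card_insert_if)
    finally show False using assms(1) by simp
  qed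
  then obtain k where k_in: "k \<in> V" "k \<noteq> i" "k \<noteq> j" by blast
  then obtain l where l_partner: "l \<in> V - {k}" "R k l" using partner by blast
  then have "R l k" using matching_onD(1)[OF matching] k_in by blast
  then have "l \<noteq> i" "l \<noteq> j" using matching_onD[OF matching] i_in j_partner k_in by blast+
  then show thesis using that[of i j k l] i_in j_partner k_in l_partner by auto
qed

lemma edge_iff_of_two_edges:
  assumes finite: "finite V" and card: "card V \<le> 5" and matching: "matching_on V R"
    and edges: "{i, j, k, l} \<subseteq> V" "distinct [i, j, k, l]" "R i j" "R k l"
    and ends: "s \<in> V" "t \<in> V" "s \<noteq> t"
  shows "R s t \<longleftrightarrow> {s, t} = {i, j} \<or> {s, t} = {k, l}"
proof
  have "R j i" "R l k" using edges matching_onD(1)[OF matching] by simp_all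
  moreover assume "{s, t} = {i, j} \<or> {s, t} = {k, l}"
  ultimately show "R s t" using edges(3,4) unfolding doubleton_eq_iff by blast
next
  assume "R s t"
  have "R t s" using matching_onD(1)[OF matching] ends \<open>R s t\<close> by blast
  have "s \<in> {i, j, k, l} \<or> t \<in> {i, j, k, l}"
  proof (rule ccontr)
    assume "\<not> ?thesis"
    then have "card {i, j, k, l, s, t} = 6" using edges(2) \<open>s \<noteq> t\<close> by auto
    moreover have "card {i, j, k, l, s, t} \<le> card V"
      using finite edges(1) ends(1,2) by (intro card_mono) auto
    ultimately show False using card by simp
  qed
  then consider (s_ij) "s \<in> {i, j}" | (s_kl) "s \<in> {k, l}"
    | (t_ij) "t \<in> {i, j}" | (t_kl) "t \<in> {k, l}" by blast
  then show "{s, t} = {i, j} \<or> {s, t} = {k, l}"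
  proof cases
    case s_ij
    then have "{s, t} = {i, j}" using edges ends \<open>R s t\<close>
      by (intro matching_on_edge_eq[OF matching]) auto
    then show ?thesis ..
  next
    case s_kl
    then have "{s, t} = {k, l}" using edges ends \<open>R s t\<close>
      by (intro matching_on_edge_eq[OF matching]) auto
    then show ?thesis ..
  next
    case t_ij
    then have "{t, s} = {i, j}" using edges ends \<open>R t s\<close>
      by (intro matching_on_edge_eq[OF matching]) auto
    then show ?thesis by (simp add: insert_commute)
  next
    case t_kl
    then have "{t, s} = {k, l}" using edges ends \<open>R t s\<close>
      by (intro matching_on_edge_eq[OF matching]) auto
    then show ?thesis by (simp add: insert_commute)
  qed
qed

subsection \<open>Vectors over the two-element field\<close>

instance bit :: finite
proof
  have "(UNIV :: bit set) = {0, 1}" by auto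
  then show "finite (UNIV :: bit set)" by (metis finite.simps)
qed

lemma bit_vec_add_self [simp]: "x + x = (0 :: bit ^ 'n)"
  by (simp add: vec_eq_iff)

lemma bit_vec_diff_eq_add: "x - y = (x + y :: bit ^ 'n)"
  by (simp add: diff_eq_eq add.assoc)

lemma sum_sym_diff_bit_vec:
  fixes f :: "'a \<Rightarrow> bit ^ 'n"
  assumes "finite S" "finite T"
  shows "sum f (sym_diff S T) = sum f S + sum f T"
proof -
  have "sum f (sym_diff S T) = sum f (S - T) + sum f (T - S)"
    using assms by (intro sum.union_disjoint) auto
  moreover have "sum f S = sum f (S \<inter> T) + sum f (S - T)"
    "sum f T = sum f (S \<inter> T) + sum f (T - S)"
    using sum.Int_Diff[OF assms(1), of f T] sum.Int_Diff[OF assms(2), of f S]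
    by (simp_all add: Int_commute)
  moreover have "(c + a) + (c + b) = (c + c) + (a + b)" for a b c :: "bit ^ 'n"
    by (simp only: ac_simps)
  ultimately show ?thesis by simp
qed

lemma sum_sym_diff_family_bit_vec:
  fixes f :: "'a \<Rightarrow> bit ^ 'n"
  assumes "finite I" "\<And>i. i \<in> I \<Longrightarrow> finite (A i)"
  shows "sum f (sym_diff_family A I) = (\<Sum>i\<in>I. sum f (A i))"
  using assms
proof (induction I)
  case (insert i I)
  then show ?case
    using sum_sym_diff_bit_vec[of "A i" "sym_diff_family A I" f] finite_sym_diff_family[of I A]
    by simp
qed simp

lemma sum_const_bit_vec: "(\<Sum>i\<in>T. a) = (if even (card T) then 0 else a :: bit ^ 'n)"
  by (induction T rule: infinite_finite_induct) (auto simp del: sum_constant)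

lemma sum_diff_const_bit_vec:
  fixes f :: "'a \<Rightarrow> bit ^ 'n"
  shows "(\<Sum>i\<in>T. f i - a) = (if even (card T) then sum f T else a + sum f T)"
  by (simp add: bit_vec_diff_eq_add sum.distrib sum_const_bit_vec add.commute del: sum_constant)

lemma independent_bit_vecI:
  fixes S :: "(bit ^ 'n) set"
  assumes "\<And>T. T \<subseteq> S \<Longrightarrow> \<Sum>T = 0 \<Longrightarrow> T = {}"
  shows "vec.independent S"
proof
  assume "vec.dependent S"
  then obtain u v where nonzero: "v \<in> S" "u v \<noteq> 0" and zero: "(\<Sum>v\<in>S. u v *s v) = 0"
    using vec.dependent_finite[of S] by auto
  have "\<Sum>{v \<in> S. u v = 1} = (\<Sum>v\<in>S. if u v = 1 then v else 0)"
    by (simp add: sum.inter_filter)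
  also have "\<dots> = (\<Sum>v\<in>S. u v *s v)"
    by (intro sum.cong) auto
  finally have "{v \<in> S. u v = 1} = {}"
    using zero by (intro assms) auto
  with nonzero show False by auto
qed

subsection \<open>Affine bases\<close>

lemma sum_in_aff: "T \<subseteq> S \<Longrightarrow> odd (card T) \<Longrightarrow> \<Sum>T \<in> aff S"
  unfolding aff_def by auto

lemma subset_aff: "S \<subseteq> aff S"
proof
  fix x assume "x \<in> S"
  then show "x \<in> aff S" using sum_in_aff[of "{x}" S] by simp
qed

lemma aff_indep_even_sum_zero:
  assumes "aff_indep B" "T \<subseteq> B" "even (card T)" "\<Sum>T = 0"
  shows "T = {}"
proof (rule ccontr)
  assume "T \<noteq> {}"
  then obtain b where b_in: "b \<in> T" by blast
  have "b + \<Sum>(T - {b}) = 0" using \<open>\<Sum>T = 0\<close> sum.remove[OF _ b_in, of "\<lambda>x. x"] by simp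
  then have "b = \<Sum>(T - {b})" by (metis bit_vec_diff_eq_add eq_iff_diff_eq_0)
  moreover have "odd (card (T - {b}))" using \<open>even (card T)\<close> b_in
    by (metis card_Suc_Diff1 even_Suc finite)
  moreover have "T - {b} \<subseteq> B - {b}" using \<open>T \<subseteq> B\<close> by blast
  ultimately have "b \<in> aff (B - {b})" using sum_in_aff by metis
  with assms(1,2) b_in show False unfolding aff_indep_def by blast
qed

lemma aff_indep_inj_on_odd_sums:
  assumes "aff_indep B" "S \<subseteq> B" "T \<subseteq> B" "odd (card S)" "odd (card T)" "\<Sum>S = \<Sum>T"
  shows "S = T"
proof -
  have "sym_diff S T = {}"
  proof (rule aff_indep_even_sum_zero[OF \<open>aff_indep B\<close>])
    show "even (card (sym_diff S T))" using assms by (simp add: even_card_sym_diff)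
    show "\<Sum>(sym_diff S T) = 0" using assms by (simp add: sum_sym_diff_bit_vec)
  qed (use assms in blast)
  then show ?thesis by blast
qed

lemma aff_indep_independent_diff:
  assumes "aff_indep B" "b \<in> B"
  shows "vec.independent ((\<lambda>x. x - b) ` (B - {b}))"
proof (rule independent_bit_vecI)
  fix S assume S_subset: "S \<subseteq> (\<lambda>x. x - b) ` (B - {b})" and sum_S: "\<Sum>S = 0"
  then obtain T where T_subset: "T \<subseteq> B - {b}" and S_eq: "S = (\<lambda>x. x - b) ` T"
    by (auto simp: subset_image_iff)
  have "\<Sum>S = (\<Sum>x\<in>T. x - b)" unfolding S_eq by (subst sum.reindex) (auto simp: inj_on_def)
  then have "(if even (card T) then \<Sum>T else b + \<Sum>T) = 0"
    using sum_S by (simp add: sum_diff_const_bit_vec)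
  moreover have "b \<notin> T" using T_subset by blast
  ultimately have "even (card T) \<and> \<Sum>T = 0 \<or> even (card (insert b T)) \<and> \<Sum>(insert b T) = 0"
    by (simp split: if_splits)
  moreover have "T \<subseteq> B" "insert b T \<subseteq> B" using T_subset \<open>b \<in> B\<close> by auto
  ultimately have "T = {}"
    using aff_indep_even_sum_zero[OF \<open>aff_indep B\<close>] by blast
  then show "S = {}" by (simp add: S_eq)
qed

lemma aff_diff_in_span:
  assumes "x \<in> aff B"
  shows "x - b \<in> vec.span ((\<lambda>x. x - b) ` (B - {b}))"
proof -
  obtain T where T_subset: "T \<subseteq> B" and odd_T: "odd (card T)" and x_eq: "x = \<Sum>T"
    using assms unfolding aff_def by blast
  have "x - b = b + x" by (simp only: bit_vec_diff_eq_add add.commute)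
  also have "\<dots> = (\<Sum>t\<in>T. t - b)" using odd_T x_eq by (simp add: sum_diff_const_bit_vec)
  also have "\<dots> \<in> vec.span ((\<lambda>x. x - b) ` (B - {b}))"
  proof (rule vec.span_sum)
    fix t assume "t \<in> T"
    then show "t - b \<in> vec.span ((\<lambda>x. x - b) ` (B - {b}))"
      using T_subset by (cases "t = b") (auto intro: vec.span_base vec.span_zero)
  qed
  finally show ?thesis .
qed

lemma card_aff_indep:
  assumes indep: "aff_indep B" and "B \<noteq> {}"
  shows "card B = Suc (flat_dim (aff B))"
proof -
  obtain b where b_in: "b \<in> B" using \<open>B \<noteq> {}\<close> by blast
  define E where "E = (\<lambda>x. x - b) ` (B - {b})"
  have "flat_dim (aff B) = card B - 1"
    unfolding flat_dim_def
  proof (rule vec.dim_unique)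
    show "E \<subseteq> {x - y |x y. x \<in> aff B \<and> y \<in> aff B}"
      using subset_aff[of B] b_in by (auto simp: E_def)
    show "{x - y |x y. x \<in> aff B \<and> y \<in> aff B} \<subseteq> vec.span E"
    proof clarify
      fix x y assume "x \<in> aff B" "y \<in> aff B"
      then have "(x - b) - (y - b) \<in> vec.span E"
        unfolding E_def by (intro vec.span_diff aff_diff_in_span)
      then show "x - y \<in> vec.span E" by simp
    qed
    show "vec.independent E" unfolding E_def by (rule aff_indep_independent_diff[OF indep b_in])
    show "card E = card B - 1"
      using b_in by (simp add: E_def card_image inj_on_def)
  qed
  moreover have "card B > 0" using \<open>B \<noteq> {}\<close> by (simp add: card_gt_0_iff)
  ultimately show ?thesis by simp
qed

lemma basis_rep:
  assumes "aff_basis B S" "x \<in> S"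
  shows basis_rep_subset: "basis_rep B x \<subseteq> B"
    and odd_card_basis_rep: "odd (card (basis_rep B x))"
    and sum_basis_rep: "\<Sum>(basis_rep B x) = x"
proof -
  have "x \<in> aff B" using assms subset_aff unfolding aff_basis_def by blast
  then have "\<exists>T. T \<subseteq> B \<and> odd (card T) \<and> \<Sum>T = x" unfolding aff_def by blast
  moreover have "aff_indep B" using assms unfolding aff_basis_def by blast
  ultimately have "\<exists>!T. T \<subseteq> B \<and> odd (card T) \<and> \<Sum>T = x"
    using aff_indep_inj_on_odd_sums by blast
  from theI'[OF this] show "basis_rep B x \<subseteq> B" "odd (card (basis_rep B x))"
    "\<Sum>(basis_rep B x) = x" unfolding basis_rep_def by blast+
qed

lemma basis_type_eq_replicate:
  assumes "\<And>x. x \<in> S - B \<Longrightarrow> card (basis_rep B x) = k"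
  shows "basis_type S B = replicate (card (S - B)) k"
proof -
  have "image_mset (\<lambda>x. card (basis_rep B x)) (mset_set (S - B)) =
      image_mset (\<lambda>_. k) (mset_set (S - B))"
    using assms by (intro image_mset_cong) simp
  also have "\<dots> = mset (replicate (card (S - B)) k)" by (simp add: image_mset_const_eq)
  finally show ?thesis
    unfolding basis_type_def by (simp add: sorted_sort_id del: mset_replicate)
qed

subsection \<open>Caps with a basis\<close>

lemma cap_even_sum_zero_card_ge_6:
  assumes "cap C" "S \<subseteq> C" "S \<noteq> {}" "even (card S)" "\<Sum>S = 0"
  shows "6 \<le> card S"
proof -
  have "card S \<noteq> 0" using \<open>S \<noteq> {}\<close> by simp
  moreover have "card S \<noteq> 2"
  proof
    assume "card S = 2"
    then obtain a b where "S = {a, b}" "a \<noteq> b" by (auto simp: card_2_iff)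
    then show False
      using \<open>\<Sum>S = 0\<close> by (simp flip: bit_vec_diff_eq_add)
  qed
  moreover have "card S \<noteq> 4" using assms unfolding cap_def quad_def by blast
  ultimately show ?thesis using \<open>even (card S)\<close> by presburger
qed

definition basis_corep :: "(bit ^ 'n) set \<Rightarrow> bit ^ 'n \<Rightarrow> (bit ^ 'n) set" where
  "basis_corep B x = B - basis_rep B x"

definition disjoint_coreps :: "(bit ^ 'n) set \<Rightarrow> bit ^ 'n \<Rightarrow> bit ^ 'n \<Rightarrow> bool" where
  "disjoint_coreps B x y \<longleftrightarrow> basis_corep B x \<inter> basis_corep B y = {}"

locale cap_with_basis =
  fixes C B :: "(bit ^ 'n) set"
  assumes cap: "cap C" and basis: "aff_basis B C"
begin

lemma rep_subset: "x \<in> C - B \<Longrightarrow> basis_rep B x \<subseteq> B"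
  using basis_rep_subset[OF basis] by blast

lemma card_sym_diff_family_basis_rep:
  assumes "I \<subseteq> C - B" "I \<noteq> {}"
  shows "6 \<le> card I + card (sym_diff_family (basis_rep B) I)"
proof -
  define E where "E = sym_diff_family (basis_rep B) I"
  have E_subset: "E \<subseteq> B"
    unfolding E_def using assms rep_subset by (intro sym_diff_family_subset) blast
  have "I \<inter> E = {}" using E_subset assms by blast
  then have card: "card (I \<union> E) = card I + card E" and sum: "\<Sum>(I \<union> E) = \<Sum>I + \<Sum>E"
    by (simp_all add: card_Un_disjoint sum.union_disjoint)
  have in_C: "x \<in> C" if "x \<in> I" for x using assms that by blast
  have "\<Sum>E = (\<Sum>x\<in>I. \<Sum>(basis_rep B x))"
    unfolding E_def by (rule sum_sym_diff_family_bit_vec) simp_all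
  also have "\<dots> = \<Sum>I"
    by (intro sum.cong sum_basis_rep[OF basis] in_C) simp_all
  finally have "\<Sum>(I \<union> E) = 0" by (simp add: sum)
  moreover have "{x \<in> I. odd (card (basis_rep B x))} = I"
    using odd_card_basis_rep[OF basis in_C] by blast
  then have "even (card E) \<longleftrightarrow> even (card I)"
    by (simp add: E_def even_card_sym_diff_family even_sum_iff)
  then have "even (card (I \<union> E))" by (simp add: card)
  moreover have "I \<union> E \<subseteq> C" using E_subset assms basis unfolding aff_basis_def by blast
  ultimately show ?thesis
    using cap_even_sum_zero_card_ge_6[OF cap, of "I \<union> E"] \<open>I \<noteq> {}\<close>
    by (simp add: card flip: E_def)
qed

lemma card_sym_diff_family_basis_corep:
  assumes "I \<subseteq> C - B" "I \<noteq> {}"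
  shows "if even (card I) then 6 \<le> card I + card (sym_diff_family (basis_corep B) I)
    else card (sym_diff_family (basis_corep B) I) + 6 \<le> card I + card B"
proof -
  define E where "E = sym_diff_family (basis_rep B) I"
  have rep: "basis_rep B x \<subseteq> B" if "x \<in> I" for x using rep_subset assms that by blast
  have "sym_diff_family (basis_corep B) I = (if even (card I) then E else B - E)"
    unfolding E_def basis_corep_def[abs_def] by (rule sym_diff_family_Diff) (simp_all add: rep)
  moreover have "E \<subseteq> B" unfolding E_def by (rule sym_diff_family_subset) (rule rep)
  then have "card (B - E) + card E = card B"
    by (simp add: card_Diff_subset card_mono)
  ultimately show ?thesis
    using card_sym_diff_family_basis_rep[OF assms] by (auto simp: E_def)
qed

end

subsection \<open>Caps of dimension 7\<close>

locale cap_dim_7 = cap_with_basis +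
  assumes dim: "cap_dim C = 7"
begin

lemma card_basis: "card B = 8"
proof -
  have "aff B = aff C" "aff_indep B" using basis unfolding aff_basis_def by blast+
  moreover have "B \<noteq> {}"
  proof
    assume "B = {}"
    then have "aff C = {}" using \<open>aff B = aff C\<close> by (auto simp: aff_def)
    then show False using dim by (simp add: cap_dim_def flat_dim_def)
  qed
  ultimately show ?thesis
    using card_aff_indep[of B] dim by (simp add: cap_dim_def)
qed

lemma card_corep_add_card_rep:
  assumes "x \<in> C - B"
  shows "card (basis_corep B x) + card (basis_rep B x) = 8"
  using card_mono[OF _ rep_subset[OF assms]] rep_subset[OF assms] card_basis
  by (simp add: basis_corep_def card_Diff_subset)

lemma card_corep_le_3:
  assumes "x \<in> C - B"
  shows "card (basis_corep B x) \<le> 3"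
  using card_sym_diff_family_basis_corep[of "{x}"] assms card_basis by simp

lemma card_corep_eq_1_or_3:
  assumes "x \<in> C - B"
  shows "card (basis_corep B x) = 1 \<or> card (basis_corep B x) = 3"
proof -
  have "odd (card (basis_rep B x))" using odd_card_basis_rep[OF basis] assms by blast
  then have "odd (card (basis_corep B x))"
    using card_corep_add_card_rep[OF assms] by presburger
  then show ?thesis using card_corep_le_3[OF assms] by presburger
qed

lemma card_corep_Int2_le:
  assumes "x \<in> C - B" "y \<in> C - B" "x \<noteq> y"
  shows "4 + 2 * card (basis_corep B x \<inter> basis_corep B y) \<le>
    card (basis_corep B x) + card (basis_corep B y)"
  using card_sym_diff_family_basis_corep[of "{x, y}"] assms
    card_sym_diff[of "basis_corep B x" "basis_corep B y"] by simp

lemma card_corep_Int_le_1: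
  assumes "x \<in> C - B" "y \<in> C - B" "x \<noteq> y"
  shows "card (basis_corep B x \<inter> basis_corep B y) \<le> 1"
  using card_corep_Int2_le[OF assms] assms(1,2)[THEN card_corep_le_3] by linarith

lemma card_corep_Int3_le:
  assumes "x \<in> C - B" "y \<in> C - B" "z \<in> C - B" "distinct [x, y, z]"
  shows "card (basis_corep B x) + card (basis_corep B y) + card (basis_corep B z)
      + 4 * card (basis_corep B x \<inter> basis_corep B y \<inter> basis_corep B z) \<le>
    5 + 2 * (card (basis_corep B x \<inter> basis_corep B y) + card (basis_corep B x \<inter> basis_corep B z)
      + card (basis_corep B y \<inter> basis_corep B z))"
  using card_sym_diff_family_basis_corep[of "{x, y, z}"] assms card_basis
    card_sym_diff_3[of "basis_corep B x" "basis_corep B y" "basis_corep B z"] by simp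

lemma corep_Int3_empty:
  assumes "x \<in> C - B" "y \<in> C - B" "z \<in> C - B" "distinct [x, y, z]"
  shows "basis_corep B x \<inter> basis_corep B y \<inter> basis_corep B z = {}"
proof -
  have ne: "x \<noteq> y" "x \<noteq> z" "y \<noteq> z" using assms(4) by auto
  have "card (basis_corep B x \<inter> basis_corep B y \<inter> basis_corep B z) = 0"
    using card_corep_Int3_le[OF assms] card_corep_Int2_le[OF assms(1,2) ne(1)]
      card_corep_Int2_le[OF assms(1,3) ne(2)] card_corep_Int2_le[OF assms(2,3) ne(3)]
      assms(1-3)[THEN card_corep_le_3]
    by presburger
  then show ?thesis by simp
qed

lemma matching_on_disjoint_coreps:
  assumes "\<And>x. x \<in> C - B \<Longrightarrow> card (basis_rep B x) = 5"
  shows "matching_on (C - B) (disjoint_coreps B)"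
proof -
  have card_3: "card (basis_corep B x) = 3" if "x \<in> C - B" for x
    using card_corep_add_card_rep[OF that] assms[OF that] by simp
  have "y = z" if dependent: "x \<in> C - B" "y \<in> C - B" "z \<in> C - B"
    and disj: "basis_corep B x \<inter> basis_corep B y = {}"
      "basis_corep B x \<inter> basis_corep B z = {}"
    for x y z
  proof (rule ccontr)
    assume "y \<noteq> z"
    moreover have "x \<noteq> y" "x \<noteq> z" using disj dependent[THEN card_3] by auto
    ultimately show False
      using card_corep_Int3_le[of x y z] card_corep_Int2_le[of y z] dependent disj
        dependent[THEN card_3] by simp
  qed
  then show ?thesis unfolding matching_on_def symp_on_def disjoint_coreps_def by blast
qed

lemma card_corep_Int_UN:
  assumes "x \<in> C - B" "Y \<subseteq> C - B - {x}"
  shows "card (basis_corep B x \<inter> (\<Union>y\<in>Y. basis_corep B y)) =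
    (\<Sum>y\<in>Y. card (basis_corep B x \<inter> basis_corep B y))"
proof -
  have "(basis_corep B x \<inter> basis_corep B y) \<inter> (basis_corep B x \<inter> basis_corep B z) = {}"
    if "y \<in> Y" "z \<in> Y" "y \<noteq> z" for y z
  proof -
    have "distinct [x, y, z]" using assms that by auto
    then show ?thesis using corep_Int3_empty[of x y z] assms that by blast
  qed
  then show ?thesis
    unfolding Int_UN_distrib by (intro card_UN_disjoint) auto
qed

lemma ex_disjoint_corep:
  assumes inj: "inj_on x I" and dependent: "x ` I \<subseteq> C - B" and s_in: "s \<in> I"
    and less: "card (basis_corep B (x s)) < card (I - {s})"
  shows "\<exists>t\<in>I - {s}. disjoint_coreps B (x s) (x t)"
proof (rule ccontr)
  assume not_disjoint: "\<not> ?thesis"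
  define Y where "Y = x ` (I - {s})"
  have Y_subset: "Y \<subseteq> C - B - {x s}" using inj dependent s_in by (auto simp: Y_def inj_on_eq_iff)
  have "1 \<le> card (basis_corep B (x s) \<inter> basis_corep B y)" if "y \<in> Y" for y
    using that not_disjoint by (auto simp: Y_def Suc_le_eq card_gt_0_iff disjoint_coreps_def)
  then have "card Y \<le> (\<Sum>y\<in>Y. card (basis_corep B (x s) \<inter> basis_corep B y))"
    using sum_mono[of Y "\<lambda>_. 1" "\<lambda>y. card (basis_corep B (x s) \<inter> basis_corep B y)"] by simp
  also have "\<dots> = card (basis_corep B (x s) \<inter> (\<Union>y\<in>Y. basis_corep B y))"
    using card_corep_Int_UN[OF _ Y_subset] dependent s_in by auto
  also have "\<dots> \<le> card (basis_corep B (x s))" by (intro card_mono) auto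
  finally show False
    using less card_image[OF inj_on_subset[OF inj], of "I - {s}"] by (simp add: Y_def)
qed

lemma card_corep_eq_1D:
  assumes "p \<in> C - B" "card (basis_corep B p) = 1" "x \<in> C - B - {p}"
  shows "card (basis_corep B x) = 3" "basis_corep B p \<inter> basis_corep B x = {}"
proof -
  have "card (basis_corep B x) = 3 \<and> card (basis_corep B p \<inter> basis_corep B x) = 0"
    using card_corep_Int2_le[of p x] card_corep_eq_1_or_3[of x] assms by auto
  then show "card (basis_corep B x) = 3" "basis_corep B p \<inter> basis_corep B x = {}" by simp_all
qed

lemma card_corep_Int_eq_1:
  assumes "p \<in> C - B" "card (basis_corep B p) = 1"
    and "x \<in> C - B - {p}" "y \<in> C - B - {p}" "x \<noteq> y"
  shows "card (basis_corep B x \<inter> basis_corep B y) = 1"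
  using card_corep_Int3_le[of p x y] card_corep_Int_le_1[of x y] assms
    card_corep_eq_1D[OF assms(1-3)] card_corep_eq_1D[OF assms(1,2,4)] by auto

lemma sym_diff_family_corep_eq_empty:
  assumes singleton: "p \<in> C - B" "card (basis_corep B p) = 1"
    and Y_subset: "Y \<subseteq> C - B - {p}" and card_Y: "card Y = 4"
  shows "sym_diff_family (basis_corep B) Y = {}"
proof -
  have "even (card {y \<in> Y. b \<in> basis_corep B y})" for b
  proof (cases "\<exists>x\<in>Y. b \<in> basis_corep B x")
    case True
    then obtain x where in_x: "x \<in> Y" "b \<in> basis_corep B x" by blast
    have "card (basis_corep B x \<inter> (\<Union>y\<in>Y - {x}. basis_corep B y)) =
        (\<Sum>y\<in>Y - {x}. card (basis_corep B x \<inter> basis_corep B y))"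
      using Y_subset in_x by (intro card_corep_Int_UN) auto
    also have "\<dots> = (\<Sum>y\<in>Y - {x}. 1)"
      using Y_subset in_x by (intro sum.cong card_corep_Int_eq_1[OF singleton]) auto
    also have "\<dots> = card (basis_corep B x)"
      using card_Y in_x Y_subset card_corep_eq_1D[OF singleton, of x] by auto
    finally have "basis_corep B x \<inter> (\<Union>y\<in>Y - {x}. basis_corep B y) = basis_corep B x"
      by (intro card_subset_eq) auto
    then obtain y where in_y: "y \<in> Y" "y \<noteq> x" "b \<in> basis_corep B y" using in_x by blast
    have "z = x \<or> z = y" if "z \<in> Y" "b \<in> basis_corep B z" for z
      using corep_Int3_empty[of x y z] in_x in_y that Y_subset by auto
    then have "{y \<in> Y. b \<in> basis_corep B y} = {x, y}" using in_x in_y by blast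
    then show ?thesis using in_y by simp
  next
    case False
    then have "{y \<in> Y. b \<in> basis_corep B y} = {}" by blast
    then show ?thesis by (simp only: card.empty even_zero)
  qed
  then show ?thesis by (simp add: sym_diff_family_def)
qed

lemma card_dependent_le_4_if_card_rep_ne_5:
  assumes dependent: "p \<in> C - B" and ne_5: "card (basis_rep B p) \<noteq> 5"
  shows "card (C - B) \<le> 4"
proof (rule ccontr)
  assume "\<not> card (C - B) \<le> 4"
  then have "4 \<le> card (C - B - {p})" using dependent by simp
  then obtain Y where Y_subset: "Y \<subseteq> C - B - {p}" and card_Y: "card Y = 4"
    by (metis obtain_subset_with_card_n)
  have "card (basis_corep B p) = 1"
    using card_corep_eq_1_or_3[OF dependent] card_corep_add_card_rep[OF dependent] ne_5
    by auto
  then have "sym_diff_family (basis_corep B) Y = {}"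
    using sym_diff_family_corep_eq_empty[OF dependent _ Y_subset card_Y] by simp
  moreover have "Y \<noteq> {}" using card_Y by auto
  ultimately show False
    using card_sym_diff_family_basis_corep[of Y] Y_subset card_Y by auto
qed

lemma card_rep_Int:
  assumes "x \<in> C - B" "y \<in> C - B" "x \<noteq> y"
    and card_5: "card (basis_rep B x) = 5" "card (basis_rep B y) = 5"
  shows "card (basis_rep B x \<inter> basis_rep B y) = (if disjoint_coreps B x y then 2 else 3)"
proof -
  have "basis_corep B x \<inter> basis_corep B y = B - (basis_rep B x \<union> basis_rep B y)"
    by (auto simp: basis_corep_def)
  moreover have Un_subset: "basis_rep B x \<union> basis_rep B y \<subseteq> B" using rep_subset assms by simp
  ultimately have "card (basis_corep B x \<inter> basis_corep B y) +
      card (basis_rep B x \<union> basis_rep B y) = 8"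
    using card_mono[OF _ Un_subset] card_basis by (simp add: card_Diff_subset)
  then have "card (basis_rep B x \<inter> basis_rep B y) = 2 + card (basis_corep B x \<inter> basis_corep B y)"
    using card_Un_Int[of "basis_rep B x" "basis_rep B y"] card_5 by simp
  moreover have "card (basis_corep B x \<inter> basis_corep B y) =
      (if disjoint_coreps B x y then 0 else 1)"
    using card_corep_Int_le_1[OF assms(1-3)] by (auto simp: le_Suc_eq disjoint_coreps_def)
  ultimately show ?thesis by simp
qed

lemma card_rep_Int_of_disjoint_pairs:
  assumes rep: "\<And>y. y \<in> C - B \<Longrightarrow> card (basis_rep B y) = 5"
    and inj: "inj_on x I" and dependent: "x ` I \<subseteq> C - B" and card_I: "finite I" "card I \<le> 5"
    and pairs: "{i, j, k, l} \<subseteq> I" "distinct [i, j, k, l]"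
      "disjoint_coreps B (x i) (x j)" "disjoint_coreps B (x k) (x l)"
    and ends: "s \<in> I" "t \<in> I" "s \<noteq> t"
  shows "card (basis_rep B (x s) \<inter> basis_rep B (x t)) =
    (if {s, t} = {i, j} \<or> {s, t} = {k, l} then 2 else 3)"
proof -
  have "matching_on I (\<lambda>s t. disjoint_coreps B (x s) (x t))"
    by (rule matching_on_reindex[OF matching_on_disjoint_coreps[OF rep] inj dependent])
  then have "disjoint_coreps B (x s) (x t) \<longleftrightarrow> {s, t} = {i, j} \<or> {s, t} = {k, l}"
    using edge_iff_of_two_edges[OF card_I _ pairs ends] by blast
  moreover have "x s \<in> C - B" "x t \<in> C - B" using dependent ends by blast+
  moreover have "x s \<noteq> x t" using inj ends by (simp add: inj_on_eq_iff)
  ultimately show ?thesis using card_rep_Int[OF _ _ _ rep rep] by simp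
qed

end

theorem theorem8p1:
  fixes C B :: "(bit ^ 'n) set"
  assumes "cap C" and "card C = 13" and "cap_dim C = 7" and "aff_basis B C"
  shows "basis_type C B = [5, 5, 5, 5, 5] \<and>
    (\<forall>x :: nat \<Rightarrow> bit ^ 'n. bij_betw x {1..5} (C - B) \<longrightarrow>
      (\<exists>i\<in>{1..5}. \<exists>j\<in>{1..5}. \<exists>k\<in>{1..5}. \<exists>l\<in>{1..5}.
        distinct [i, j, k, l] \<and>
        card (basis_rep B (x i) \<inter> basis_rep B (x j)) = 2 \<and>
        card (basis_rep B (x k) \<inter> basis_rep B (x l)) = 2 \<and>
        (\<forall>s\<in>{1..5}. \<forall>t\<in>{1..5}. s \<noteq> t \<and> {s, t} \<noteq> {i, j} \<and> {s, t} \<noteq> {k, l} \<longrightarrow>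
          card (basis_rep B (x s) \<inter> basis_rep B (x t)) = 3)))"
    (is "_ \<and> (\<forall>x. _ x \<longrightarrow> ?pairs x)")
proof -
  interpret cap_dim_7 C B by unfold_locales (use assms in auto)
  have card_dependent: "card (C - B) = 5"
    using card_basis assms by (simp add: aff_basis_def card_Diff_subset)
  have rep: "card (basis_rep B y) = 5" if "y \<in> C - B" for y
    using card_dependent_le_4_if_card_rep_ne_5[OF that] card_dependent by linarith
  have "?pairs x" if "bij_betw x {1..5} (C - B)" for x
  proof -
    have family: "inj_on x {1..5}" "x ` {1..5} \<subseteq> C - B" using that by (simp_all add: bij_betw_def)
    have partner: "\<exists>t\<in>{1..5} - {s}. disjoint_coreps B (x s) (x t)" if s_in: "s \<in> {1..5}" for s
    proof (rule ex_disjoint_corep[OF family s_in])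
      have "card (basis_corep B (x s)) \<le> 3" using family s_in by (intro card_corep_le_3) blast
      then show "card (basis_corep B (x s)) < card ({1..5} - {s})" using s_in by simp
    qed
    obtain i j k l where pairs: "{i, j, k, l} \<subseteq> {1..5}" "distinct [i, j, k, l]"
      "disjoint_coreps B (x i) (x j)" "disjoint_coreps B (x k) (x l)"
      by (rule obtain_two_disjoint_edges
          [OF _ matching_on_reindex[OF matching_on_disjoint_coreps[OF rep] family] partner])
        simp_all
    with card_rep_Int_of_disjoint_pairs[OF rep family _ _ pairs] show ?thesis
      by (intro bexI[of _ i] bexI[of _ j] bexI[of _ k] bexI[of _ l]) simp_all
  qed
  moreover have "basis_type C B = [5, 5, 5, 5, 5]"
    using basis_type_eq_replicate[OF rep] card_dependent by (simp add: numeral_eq_Suc)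
  ultimately show ?thesis by blast
qed

end
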